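(* Let $d\mu$ be a nontrivial probability measure on $\partial\mathbb{D}$ with Verblunsky coefficients $\{\alpha_n\}_{n=0}^\infty\in\mathbb{D}^\infty$, let $\{\beta_n\}_{n=1}^\infty$ be a sequence in $\partial\mathbb{D}$, and let $\tilde\Phi_n(z)=\Phi_n(z,d\mu;\beta_n)$ for $n\ge1$. For $n\ge 1$ define $$\lambda_n=\bar\beta_{n+1}\,\bar\beta_n\,\left(\frac{\beta_n\alpha_n-1}{\bar\beta_n\bar\alpha_n-1}\right)\in\partial\mathbb{D}.$$ Then for each $n$, one of the following two possibilities holds: (i) $\tilde\Phi_n$ and $\tilde\Phi_{n+1}$ have no zeros in common. In that case, $\lambda_n$ is not a zero of either, and $\{\text{zeros of }\tilde\Phi_n\}\cup\{\lambda_n\}$ strictly interlaces $\{\text{zeros of }\tilde\Phi_{n+1}\}$. (ii) $\tilde\Phi_n$ and $\tilde\Phi_{n+1}$ have a single zero in common. In that case, $\lambda_n$ is that zero, and $\{\text{zeros of }\tilde\Phi_n\}$ strictly interlaces $\{\text{zeros of }\tilde\Phi_{n+1}\}\setminus\{\lambda_n\}$.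
   Context: $\mathbb{D}=\{z\in\mathbb{C}:|z|<1\}$ and $\partial\mathbb{D}=\{z\in\mathbb{C}:|z|=1\}$. A probability measure on $\partial\mathbb{D}$ is nontrivial if its support is infinite. Its monic orthogonal polynomials $\Phi_n(z)=\Phi_n(z,d\mu)$ (with $\Phi_0=1$) obey the Szegő recursion $\Phi_{n+1}(z)=z\Phi_n(z)-\bar\alpha_n\Phi_n^*(z)$, where $\Phi_n^*(z)=z^n\,\overline{\Phi_n(1/\bar z)}$ and $\alpha_n=\alpha_n(d\mu)\in\mathbb{D}$, $n\ge 0$, are the Verblunsky coefficients of $d\mu$. For $n\ge 1$ and $\beta\in\partial\mathbb{D}$, the paraorthogonal polynomial is $\Phi_n(z,d\mu;\beta)=z\Phi_{n-1}(z,d\mu)-\bar\beta\,\Phi_{n-1}^*(z,d\mu)$. It has $n$ distinct zeros, all on $\partial\mathbb{D}$. For distinct $z,w\in\partial\mathbb{D}$, $(z,w)$ is the open arc of $\zeta\in\partial\mathbb{D}$ with $\mathrm{Arg}(z)<\mathrm{Arg}(\zeta)<\mathrm{Arg}(w)$, where the branch of $\mathrm{Arg}$ is chosen so that $0<\mathrm{Arg}(w)-\mathrm{Arg}(z)<2\pi$ (the counterclockwise arc from $z$ to $w$). Points $(z_1,\dots,z_\ell)$ (distinct) in $\partial\mathbb{D}$ are cyclicly ordered if none of the arcs $(z_j,z_{j+1})$, $1\le j\le\ell-1$, and $(z_\ell,z_1)$ contains any $z_k$. Two cyclicly ordered sets $(z_1,\dots,z_\ell)$ and $(w_1,\dots,w_\ell)$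 strictly interlace if, after a cyclic permutation of the $w$'s, $w_j\in(z_j,z_{j+1})$ for $j=1,\dots,\ell-1$ and $w_\ell\in(z_\ell,z_1)$; when $\ell=1$ this is read as $w_1\ne z_1$. Finite sets of points are always taken cyclicly ordered when speaking of interlacing.
   Formalization: The printed λ_n is wrong (Lebesgue measure, n=1, β_1=i, β_2=−1: common zero −i but printed λ_1=i); the formal statement uses λ_n = β̄_{n+1} β_n (β̄_n α_{n−1} − 1)/(β_n ᾱ_{n−1} − 1), i.e. α_n replaced by α_{n−1} and β_n exchanged with its conjugate. *)

theory Defs
  imports "HOL-Probability.Probability" "HOL-Computational_Algebra.Polynomial"
begin

section \<open>Measures on the unit circle\<close>

definition circle_support :: "complex measure \<Rightarrow> complex set" where
  "circle_support M =
     {z \<in> sphere 0 1. \<forall>U. open U \<and> z \<in> U \<longrightarrow> emeasure M (U \<inter> sphere 0 1) > 0}"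

definition nontrivial_circle_measure :: "complex measure \<Rightarrow> bool" where
  "nontrivial_circle_measure M \<longleftrightarrow>
     prob_space M \<and> sets M = sets (restrict_space borel (sphere 0 1)) \<and>
     infinite (circle_support M)"

section \<open>Orthogonal polynomials and Verblunsky coefficients\<close>

definition is_monic_OP :: "complex measure \<Rightarrow> nat \<Rightarrow> complex poly \<Rightarrow> bool" where
  "is_monic_OP M n p \<longleftrightarrow>
     degree p = n \<and> lead_coeff p = 1 \<and>
     (\<forall>j<n. (LINT z|M. cnj (z ^ j) * poly p z) = 0)"

definition OPUC :: "complex measure \<Rightarrow> nat \<Rightarrow> complex poly" where
  "OPUC M n = (THE p. is_monic_OP M n p)"

text \<open>
  The reversal is taken with respect to the actual degree of the polynomial, which is the
  index \<open>n\<close> in the case of \<open>OPUC M n\<close>. It is kept as a polynomial, because the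
  formula in \<open>poly_rev_star\<close> does not define its value at 0.
\<close>

definition rev_star :: "complex poly \<Rightarrow> complex poly" where
  "rev_star p = reflect_poly (map_poly cnj p)"

lemma poly_rev_star:
  assumes "z \<noteq> 0"
  shows "poly (rev_star p) z = z ^ degree p * cnj (poly p (1 / cnj z))"
proof -
  have "poly (map_poly cnj p) (inverse z) = cnj (poly p (1 / cnj z))"
    by (simp add: poly_altdef coeff_map_poly degree_map_poly inverse_eq_divide)
  then show ?thesis
    using assms by (simp add: rev_star_def poly_reflect_poly_nz degree_map_poly)
qed

text \<open>The Szego recursion, used as the defining equation of the coefficients.\<close>

definition verblunsky :: "complex measure \<Rightarrow> nat \<Rightarrow> complex" where
  "verblunsky M n =
     (THE a. OPUC M (Suc n) = [:0, 1:] * OPUC M n - smult (cnj a) (rev_star (OPUC M n)))"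

definition POPUC :: "complex measure \<Rightarrow> nat \<Rightarrow> complex \<Rightarrow> complex poly" where
  "POPUC M n b = [:0, 1:] * OPUC M (n - 1) - smult (cnj b) (rev_star (OPUC M (n - 1)))"

definition zeros :: "complex poly \<Rightarrow> complex set" where
  "zeros p = {z. poly p z = 0}"

text \<open>
  The source prints, for this point,
  \<open>cnj (\<beta> (n+1)) * cnj (\<beta> n) * ((\<beta> n * \<alpha> n - 1) / (cnj (\<beta> n) * cnj (\<alpha> n) - 1))\<close>.
  That is a misprint: no \<open>\<alpha> k\<close> with \<open>k \<ge> n\<close> enters the \<open>n\<close>-th and \<open>(n+1)\<close>-st paraorthogonal
  polynomials, and for normalized Lebesgue measure (all \<open>\<alpha> k = 0\<close>) these are
  \<open>z^n - cnj (\<beta> n)\<close> and \<open>z^(n+1) - cnj (\<beta> (n+1))\<close>, whose only possible common zero is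
  \<open>cnj (\<beta> (n+1)) * \<beta> n\<close>. Below, \<open>\<alpha> n\<close> is replaced by \<open>\<alpha> (n-1)\<close>, and \<open>\<beta> n\<close> is exchanged with
  its conjugate. This is what elimination gives: where \<open>z * \<Phi> (n-1) = cnj (\<beta> n) * \<Phi>* (n-1)\<close>,
  the \<open>(n+1)\<close>-st paraorthogonal polynomial equals
  \<open>(z * (cnj (\<beta> n) - cnj (\<alpha> (n-1))) - cnj (\<beta> (n+1)) * (1 - \<alpha> (n-1) * cnj (\<beta> n))) * \<Phi>* (n-1)\<close>.
\<close>

definition interlacing_point :: "(nat \<Rightarrow> complex) \<Rightarrow> (nat \<Rightarrow> complex) \<Rightarrow> nat \<Rightarrow> complex" where
  "interlacing_point \<alpha> \<beta> n =
     cnj (\<beta> (n + 1)) * \<beta> n *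
       ((cnj (\<beta> n) * \<alpha> (n - 1) - 1) / (\<beta> n * cnj (\<alpha> (n - 1)) - 1))"

section \<open>Cyclic order and interlacing\<close>

text \<open>
  Here \<open>a\<close>, \<open>t\<close>, \<open>b\<close> are the values of \<open>Arg\<close> at \<open>z\<close>, \<open>\<zeta>\<close>, \<open>w\<close> for a suitable branch.
  The arc is empty for \<open>z = w\<close>.
\<close>

definition circle_arc :: "complex \<Rightarrow> complex \<Rightarrow> complex set" where
  "circle_arc z w =
     {\<zeta>. \<exists>a t b. z = cis a \<and> \<zeta> = cis t \<and> w = cis b \<and>
        0 < b - a \<and> b - a < 2 * pi \<and> a < t \<and> t < b}"

text \<open>Lists are indexed from 0; reducing \<open>j + 1\<close> modulo the length covers the closing arc.\<close>

definition cyclicly_ordered :: "complex list \<Rightarrow> bool" where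
  "cyclicly_ordered zs \<longleftrightarrow>
     distinct zs \<and> set zs \<subseteq> sphere 0 1 \<and>
     (\<forall>j<length zs. \<forall>k<length zs.
        zs ! k \<notin> circle_arc (zs ! j) (zs ! ((j + 1) mod length zs)))"

definition strictly_interlace_list :: "complex list \<Rightarrow> complex list \<Rightarrow> bool" where
  "strictly_interlace_list zs ws \<longleftrightarrow>
     length zs = length ws \<and>
     (if length zs = 1 then ws ! 0 \<noteq> zs ! 0
      else \<exists>m. \<forall>j<length zs.
             rotate m ws ! j \<in> circle_arc (zs ! j) (zs ! ((j + 1) mod length zs)))"

text \<open>
  Finite subsets of the circle are enumerated in cyclic order. Such an enumeration is unique up
  to rotation, so the choice is immaterial.
\<close>

definition strictly_interlace :: "complex set \<Rightarrow> complex set \<Rightarrow> bool" where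
  "strictly_interlace Z W \<longleftrightarrow>
     (\<exists>zs ws. set zs = Z \<and> set ws = W \<and> cyclicly_ordered zs \<and> cyclicly_ordered ws \<and>
        strictly_interlace_list zs ws)"

end

theory Submission
  imports Defs
begin

text \<open>
  On the circle, \<open>z * \<Phi>\<^sub>k / \<Phi>\<^sub>k\<^sup>*\<close> is \<open>cis (\<eta>\<^sub>k t)\<close> at \<open>z = cis t\<close> with \<open>\<eta>\<^sub>k\<close> continuous and strictly
  increasing, gaining \<open>2 * pi * (k + 1)\<close> over a period: by the Szego recursion,
  \<open>\<eta>\<^sub>k\<^sub>+\<^sub>1 t = t + L (\<eta>\<^sub>k t)\<close>, where \<open>L\<close> lifts the disc automorphism with parameter \<open>cnj (\<alpha> k)\<close>,
  and \<open>\<bar>\<alpha> k\<bar> < 1\<close>. For \<open>k = n - 1\<close>, put \<open>f t = L (\<eta>\<^sub>k t) - L B\<close> with \<open>cnj (\<beta> n) = cis B\<close>, and let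
  \<open>cis s\<close> be the interlacing point. The zeros of the \<open>n\<close>-th paraorthogonal polynomial are the points
  \<open>cis t\<close> where \<open>f t\<close> is a multiple of \<open>2 * pi\<close>, and those of the next one are the points where
  \<open>f t + (t - s)\<close> is. Interlacing becomes a statement about two increasing functions: between
  consecutive points where \<open>f t\<close> or \<open>t - s\<close> is a multiple of \<open>2 * pi\<close>, their sum passes
  exactly one multiple. A common zero occurs exactly where both terms are multiples, which forces
  \<open>cis t = cis s\<close>.
\<close>

section \<open>The Szego recursion\<close>

definition circle_inner :: "complex measure \<Rightarrow> complex poly \<Rightarrow> complex poly \<Rightarrow> complex" where
  "circle_inner M p q = (LINT z|M. cnj (poly p z) * poly q z)"

lemma poly_rev_star_circle:
  assumes "norm z = 1"
  shows "poly (rev_star p) z = z ^ degree p * cnj (poly p z)"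
proof -
  have "z \<noteq> 0" "1 / cnj z = z"
    using assms complex_norm_square[of z] by (auto simp: divide_eq_eq)
  then show ?thesis by (simp add: poly_rev_star)
qed

lemma degree_rev_star_le: "degree (rev_star p) \<le> degree p"
  by (metis degree_map_poly complex_cnj_zero_iff degree_reflect_poly_le rev_star_def)

section \<open>The inner product of polynomials on the circle\<close>

locale circle_measure =
  fixes M :: "complex measure"
  assumes nontrivial: "nontrivial_circle_measure M"
begin

sublocale prob_space M
  using nontrivial by (simp add: nontrivial_circle_measure_def)

lemma sets_M: "sets M = sets (restrict_space borel (sphere 0 1))"
  using nontrivial by (simp add: nontrivial_circle_measure_def)

lemma space_M: "space M = sphere 0 1"
  using sets_eq_imp_space_eq[OF sets_M] by (simp add: space_restrict_space)

lemma integrable_continuous: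
  fixes f :: "complex \<Rightarrow> complex"
  assumes "continuous_on UNIV f"
  shows "integrable M f"
proof -
  have "f \<in> borel_measurable (restrict_space borel (sphere 0 1))"
    using borel_measurable_continuous_onI[OF assms] by (rule measurable_restrict_space1)
  then have meas: "f \<in> borel_measurable M"
    using measurable_cong_sets[OF sets_M refl] by blast
  have "compact (f ` sphere 0 1)"
    by (intro compact_continuous_image continuous_on_subset[OF assms] compact_sphere) auto
  then obtain B where "\<forall>x\<in>sphere 0 1. norm (f x) \<le> B"
    using compact_imp_bounded bounded_iff by (metis image_eqI)
  then have "AE x in M. norm (f x) \<le> B"
    by (intro AE_I2) (simp add: space_M)
  with meas show ?thesis
    by (intro integrable_const_bound[of _ B]) auto
qed

lemma integrable_inner [simp]: "integrable M (\<lambda>z. cnj (poly p z) * poly q z)"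
  by (intro integrable_continuous continuous_intros)

lemma inner_cong:
  assumes "\<And>z. norm z = 1 \<Longrightarrow> cnj (poly p z) * poly q z = cnj (poly p' z) * poly q' z"
  shows "circle_inner M p q = circle_inner M p' q'"
  unfolding circle_inner_def
  by (rule Bochner_Integration.integral_cong) (use assms in \<open>auto simp: space_M\<close>)

lemma inner_diff_right: "circle_inner M p (q - r) = circle_inner M p q - circle_inner M p r"
  unfolding circle_inner_def
  by (simp add: ring_distribs flip: Bochner_Integration.integral_diff)

lemma inner_add_right: "circle_inner M p (q + r) = circle_inner M p q + circle_inner M p r"
  unfolding circle_inner_def
  by (simp add: ring_distribs flip: Bochner_Integration.integral_add)

lemma inner_smult_right: "circle_inner M p (smult c q) = c * circle_inner M p q"
  unfolding circle_inner_def
  by (simp add: algebra_simps flip: integral_mult_right_zero)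

lemma inner_commute: "circle_inner M q p = cnj (circle_inner M p q)"
  unfolding circle_inner_def Bochner_Integration.integral_cnj[of M "\<lambda>z. cnj (poly p z) * poly q z", symmetric]
  by (simp add: mult.commute)

lemma inner_sum_left: "circle_inner M (\<Sum>i\<in>A. f i) p = (\<Sum>i\<in>A. circle_inner M (f i) p)"
  unfolding circle_inner_def
  by (simp add: poly_sum sum_distrib_right)

lemma inner_smult_left: "circle_inner M (smult c q) p = cnj c * circle_inner M q p"
  by (metis inner_commute inner_smult_right complex_cnj_mult)

lemma inner_self_eq_norm:
  "circle_inner M p p = of_real (LINT z|M. (norm (poly p z))\<^sup>2)"
  unfolding circle_inner_def
  unfolding integral_complex_of_real[symmetric] complex_norm_square
  by (simp only: mult.commute)

text \<open>A vanishing norm would force \<open>p = 0\<close> almost everywhere. But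
  \<open>p\<close> has only finitely many roots and the support is infinite, so some support point
  is not a root, and the open set where \<open>p\<close> does not vanish has positive mass.\<close>

lemma inner_self_pos:
  assumes "p \<noteq> 0"
  shows "\<exists>N>0. circle_inner M p p = of_real N"
proof -
  let ?f = "\<lambda>z. (norm (poly p z))\<^sup>2"
  have int: "integrable M ?f"
    using integrable_Re[OF integrable_inner[of p p]]
    unfolding cmod_power2 by (simp add: power2_eq_square)
  have "(LINT z|M. ?f z) \<noteq> 0"
  proof
    assume "(LINT z|M. ?f z) = 0"
    then have ae: "AE z in M. poly p z = 0"
      using integral_nonneg_eq_0_iff_AE[OF int] by simp
    have "finite {z. poly p z = 0}"
      using assms by (rule poly_roots_finite)
    moreover have "infinite (circle_support M)"
      using nontrivial by (simp add: nontrivial_circle_measure_def)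
    ultimately obtain w where w: "w \<in> circle_support M" "poly p w \<noteq> 0"
      by (metis (mono_tags, lifting) finite_subset mem_Collect_eq subsetI)
    let ?U = "{z. poly p z \<noteq> 0}"
    have "open ?U"
      by (intro open_Collect_neq continuous_intros)
    with w have pos: "emeasure M (?U \<inter> sphere 0 1) > 0"
      by (auto simp: circle_support_def)
    have "?U \<inter> sphere 0 1 \<in> sets M"
      using \<open>open ?U\<close> unfolding sets_M
      by (auto simp: sets_restrict_space intro!: image_eqI[of _ _ ?U])
    then have "emeasure M (?U \<inter> sphere 0 1) = 0"
      using ae by (subst (asm) AE_iff_measurable[of "?U \<inter> sphere 0 1"])
        (auto simp: space_M)
    with pos show False by simp
  qed
  moreover have "(LINT z|M. ?f z) \<ge> 0"
    by simp
  ultimately show ?thesis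
    using inner_self_eq_norm[of p] by (metis less_eq_real_def)
qed

section \<open>Monic orthogonal polynomials: uniqueness, existence and recursion\<close>

lemma is_monic_OP_inner:
  "is_monic_OP M n p \<longleftrightarrow> degree p = n \<and> lead_coeff p = 1 \<and>
     (\<forall>j<n. circle_inner M (monom 1 j) p = 0)"
  by (simp add: is_monic_OP_def circle_inner_def poly_monom)

text \<open>Expansion in monomials reduces this to the defining conditions. Bounding coefficients
  instead of the degree keeps \<open>n = 0\<close> meaningful: there \<open>q\<close> must be
  zero.\<close>

lemma monic_OP_orthogonal:
  assumes "is_monic_OP M n p" "\<And>i. i \<ge> n \<Longrightarrow> coeff q i = 0"
  shows "circle_inner M q p = 0"
proof -
  have "q = (\<Sum>i\<le>degree q. smult (coeff q i) (monom 1 i))"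
    by (simp add: smult_monom poly_as_sum_of_monoms)
  then have "circle_inner M q p =
      (\<Sum>i\<le>degree q. cnj (coeff q i) * circle_inner M (monom 1 i) p)"
    by (metis (no_types, lifting) inner_smult_left inner_sum_left sum.cong)
  also have "\<dots> = 0"
  proof (rule sum.neutral, safe)
    fix i
    show "cnj (coeff q i) * circle_inner M (monom 1 i) p = 0"
      using assms by (cases "i < n") (auto simp: is_monic_OP_inner)
  qed
  finally show ?thesis .
qed

text \<open>The leading terms cancel in \<open>p - q\<close>, so it is orthogonal to both
  \<open>p\<close> and \<open>q\<close>, hence to itself.\<close>

lemma monic_OP_unique:
  assumes p: "is_monic_OP M n p" and q: "is_monic_OP M n q"
  shows "p = q"
proof (rule ccontr)
  assume "p \<noteq> q"
  then have "circle_inner M (p - q) (p - q) \<noteq> 0"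
    using inner_self_pos[of "p - q"] by fastforce
  moreover have "coeff (p - q) i = 0" if "i \<ge> n" for i
    using p q that by (cases "i = n") (auto simp: is_monic_OP_inner coeff_eq_0)
  then have "circle_inner M (p - q) (p - q) = 0"
    using monic_OP_orthogonal[OF p] monic_OP_orthogonal[OF q] by (simp add: inner_diff_right)
  ultimately show False by simp
qed

lemma OPUC_eqI: "is_monic_OP M n p \<Longrightarrow> OPUC M n = p"
  unfolding OPUC_def by (rule the_equality) (auto intro: monic_OP_unique)

text \<open>Both \<open>z * p\<close> and the reversal of \<open>p\<close> are orthogonal to
  \<open>z, ..., z^n\<close>, so a suitable \<open>a\<close> only has to arrange orthogonality to 1.
  The bound on \<open>a\<close> is Pythagoras: \<open>z * p\<close> and the reversal have the same
  norm as \<open>p\<close>, and the new polynomial has positive norm.\<close>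

lemma szego_step:
  assumes p: "is_monic_OP M n p"
  shows "\<exists>a. norm a < 1 \<and>
    is_monic_OP M (Suc n) ([:0, 1:] * p - smult (cnj a) (rev_star p))"
proof -
  have deg: "degree p = n" and lead: "coeff p n = 1" and "p \<noteq> 0"
    using p by (auto simp: is_monic_OP_def)
  obtain N where N: "N > 0" "circle_inner M p p = of_real N"
    using inner_self_pos \<open>p \<noteq> 0\<close> by blast
  \<comment> \<open>This value makes \<open>q\<close> orthogonal to 1, because
    \<open>circle_inner M 1 (rev_star p)\<close> is also \<open>N\<close> (see
    \<open>rev_0\<close>).\<close>
  define a where "a = cnj (circle_inner M 1 ([:0, 1:] * p) / N)"
  define q where "q = [:0, 1:] * p - smult (cnj a) (rev_star p)"
  have rev_j: "circle_inner M (monom 1 j) (rev_star p) = cnj (circle_inner M (monom 1 (n - j)) p)"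
    if "j \<le> n" for j
  proof -
    have *: "cnj z ^ j * z ^ n = z ^ (n - j)" if "norm z = 1" for z :: complex
    proof -
      have "cnj z ^ j * z ^ n = (z * cnj z) ^ j * z ^ (n - j)"
        using \<open>j \<le> n\<close> by (simp add: power_mult_distrib flip: power_add mult.assoc)
      then show ?thesis
        using that by (simp add: complex_norm_square[symmetric])
    qed
    have "circle_inner M (monom 1 j) (rev_star p) = circle_inner M p (monom 1 (n - j))"
      by (rule inner_cong)
        (simp add: poly_rev_star_circle deg poly_monom flip: * mult.assoc)
    then show ?thesis by (metis inner_commute)
  qed
  \<comment> \<open>As \<open>p\<close> is monic, its product with \<open>z^n\<close> is again
    \<open>N\<close>; reversal turns this into the product of 1 with
    \<open>rev_star p\<close>.\<close>
  have "circle_inner M (p - monom 1 n) p = 0"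
    by (rule monic_OP_orthogonal[OF p])
      (use deg lead in \<open>auto simp: coeff_eq_0 dest: le_neq_implies_less\<close>)
  then have "circle_inner M (monom 1 n) p = N"
    using N inner_diff_right[of p p "monom 1 n"]
    by (metis complex_cnj_cancel_iff complex_cnj_zero eq_iff_diff_eq_0 inner_commute
        complex_cnj_complex_of_real)
  then have rev_0: "circle_inner M 1 (rev_star p) = N"
    using rev_j[of 0] by (simp flip: one_poly_eq_simps)
  have deg_rev: "coeff (rev_star p) i = 0" if "i > n" for i
    using degree_rev_star_le[of p] deg that by (simp add: coeff_eq_0)
  have "circle_inner M (monom 1 j) q = 0" if "j < Suc n" for j
  proof (cases j)
    case 0
    then show ?thesis
      using N rev_0 by (simp add: q_def a_def inner_diff_right inner_smult_right)
  next
    case (Suc i)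
    have "circle_inner M (monom 1 j) ([:0, 1:] * p) = circle_inner M (monom 1 i) p"
    proof (rule inner_cong)
      fix z :: complex
      assume "norm z = 1"
      then have "cnj z * z = 1"
        by (simp add: complex_norm_square[symmetric] mult.commute)
      then show "cnj (poly (monom 1 j) z) * poly ([:0, 1:] * p) z
          = cnj (poly (monom 1 i) z) * poly p z"
        by (simp add: Suc poly_monom algebra_simps)
    qed
    moreover have "circle_inner M (monom 1 (n - j)) p = 0" "circle_inner M (monom 1 i) p = 0"
      using p that Suc by (auto simp: is_monic_OP_inner)
    ultimately show ?thesis
      using that by (simp add: q_def inner_diff_right inner_smult_right rev_j)
  qed
  moreover have "coeff q (Suc n) = 1"
    by (simp add: q_def lead deg_rev)
  moreover have "degree q = Suc n"
  proof (rule antisym)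
    show "degree q \<le> Suc n"
      by (rule degree_le) (use deg in \<open>auto simp: q_def deg_rev coeff_pCons coeff_eq_0 split: nat.split\<close>)
    show "Suc n \<le> degree q"
      using \<open>coeff q (Suc n) = 1\<close> by (intro le_degree) simp
  qed
  ultimately have q: "is_monic_OP M (Suc n) q"
    by (simp add: is_monic_OP_inner)
  then have "q \<noteq> 0"
    by (auto simp: is_monic_OP_def)
  then obtain K where K: "K > 0" "circle_inner M q q = of_real K"
    using inner_self_pos by blast
  \<comment> \<open>The reversal has degree at most \<open>n\<close>, below that of
    \<open>q\<close>; so \<open>zp\<close> below is an orthogonal decomposition.\<close>
  have qr: "circle_inner M (rev_star p) q = 0"
    by (rule monic_OP_orthogonal[OF q]) (simp add: deg_rev)
  have unit: "cnj z * z = 1" if "norm z = 1" for z :: complex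
    using that by (simp add: complex_norm_square[symmetric] mult.commute)
  have Nz: "circle_inner M ([:0, 1:] * p) ([:0, 1:] * p) = N"
    unfolding N(2)[symmetric]
    by (rule inner_cong) (use unit in \<open>simp add: algebra_simps\<close>)
  have Nr: "circle_inner M (rev_star p) (rev_star p) = N"
    unfolding N(2)[symmetric]
  proof (rule inner_cong)
    fix z :: complex
    assume z: "norm z = 1"
    then have "cnj z ^ n * z ^ n = 1"
      using unit by (metis power_mult_distrib power_one)
    then show "cnj (poly (rev_star p) z) * poly (rev_star p) z = cnj (poly p z) * poly p z"
      using z by (simp add: poly_rev_star_circle deg algebra_simps)
  qed
  have zp: "[:0, 1:] * p = q + smult (cnj a) (rev_star p)"
    by (simp add: q_def)
  have "circle_inner M ([:0, 1:] * p) ([:0, 1:] * p) =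
      circle_inner M q q + cnj a * a * circle_inner M (rev_star p) (rev_star p)"
  proof -
    have "circle_inner M q (rev_star p) = 0"
      using qr by (metis inner_commute complex_cnj_zero)
    moreover have add_left: "circle_inner M (r + s) t = circle_inner M r t + circle_inner M s t" for r s t
      by (metis inner_commute inner_add_right complex_cnj_add)
    ultimately show ?thesis
      unfolding zp using qr
      by (simp add: inner_add_right inner_smult_right inner_smult_left add_left)
  qed
  then have "of_real N = (of_real (K + (norm a)\<^sup>2 * N) :: complex)"
    unfolding of_real_add of_real_mult complex_norm_square Nz Nr K(2)
    by (simp only: mult.commute)
  then have "N = K + (norm a)\<^sup>2 * N"
    by (simp only: of_real_eq_iff)
  then have "(norm a)\<^sup>2 * N < 1 * N"
    using K(1) by linarith
  then have "(norm a)\<^sup>2 < 1\<^sup>2"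
    using N(1) by (simp add: mult_less_cancel_right)
  then have "norm a < 1"
    by (rule power_less_imp_less_base) simp
  with q show ?thesis
    unfolding q_def by blast
qed

lemma OPUC_is_monic_OP: "is_monic_OP M n (OPUC M n)"
proof (induction n)
  case 0
  have "is_monic_OP M 0 1"
    by (simp add: is_monic_OP_def)
  then show ?case by (metis OPUC_eqI)
next
  case (Suc n)
  then show ?case using szego_step OPUC_eqI by metis
qed

lemma degree_OPUC [simp]: "degree (OPUC M n) = n"
  and coeff_OPUC [simp]: "coeff (OPUC M n) n = 1"
  using OPUC_is_monic_OP[of n] by (auto simp: is_monic_OP_def)

text \<open>Existence and the bound come from \<open>szego_step\<close>. The reversed polynomial is
  nonzero, so the coefficient is unique and the definite description in \<open>verblunsky\<close>
  denotes it.\<close>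

lemma szego_recursion:
  "OPUC M (Suc n) = [:0, 1:] * OPUC M n - smult (cnj (verblunsky M n)) (rev_star (OPUC M n))"
  and norm_verblunsky_less_one: "norm (verblunsky M n) < 1"
proof -
  let ?P = "\<lambda>a. OPUC M (Suc n) = [:0, 1:] * OPUC M n - smult (cnj a) (rev_star (OPUC M n))"
  obtain a where a: "norm a < 1" "?P a"
    using szego_step[OF OPUC_is_monic_OP[of n]] OPUC_eqI by blast
  have "rev_star (OPUC M n) \<noteq> 0"
    unfolding rev_star_def reflect_poly_eq_0_iff
    using degree_OPUC[of n] coeff_OPUC[of n]
    by (metis complex_cnj_one coeff_0 coeff_map_poly complex_cnj_zero zero_neq_one)
  moreover have "smult (cnj b - cnj a) (rev_star (OPUC M n)) = 0" if "?P b" for b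
    using that a(2) by (simp add: smult_diff_left)
  ultimately have "b = a" if "?P b" for b
    using that by fastforce
  then have "verblunsky M n = a"
    unfolding verblunsky_def using a(2) by (intro the_equality) auto
  with a show "?P (verblunsky M n)" "norm (verblunsky M n) < 1"
    by auto
qed

end

section \<open>Interlacing of level sets on the circle\<close>

lemma cis_eq_iff: "cis s = cis t \<longleftrightarrow> (\<exists>k::int. s = t + 2 * pi * k)"
  using sin_cos_eq_iff[of s t] by (auto simp: complex_eq_iff)

lemma cis_add_2pi_int [simp]: "cis (t + 2 * pi * of_int k) = cis t"
  using cis_eq_iff by blast

lemma cis_neq:
  assumes "s < t" "t < s + 2 * pi"
  shows "cis s \<noteq> cis t"
proof
  assume "cis s = cis t"
  then obtain k :: int where "t = s + 2 * pi * k"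
    by (metis cis_eq_iff)
  with assms have "0 < 2 * pi * of_int k" "2 * pi * of_int k < 2 * pi * 1"
    by auto
  then have "0 < k" "k < 1"
    by (simp_all add: zero_less_mult_iff)
  then show False by simp
qed

lemma increasing_upto:
  fixes p :: "nat \<Rightarrow> real"
  assumes "\<And>j. j < l \<Longrightarrow> p j < p (Suc j)" "i < j" "j \<le> l"
  shows "p i < p j"
  using assms(2,3)
proof (induction j)
  case (Suc j)
  then show ?case
    using assms(1)[of j] by (cases "i = j") auto
qed simp

text \<open>The list covers one period. The index that wraps around to 0 may be read as
  \<open>l\<close>, since \<open>p l\<close> and \<open>p 0\<close> differ by a full turn.\<close>

lemma cis_next_index:
  fixes p :: "nat \<Rightarrow> real"
  assumes "p l = p 0 + 2 * pi" "j < l"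
  shows "map (\<lambda>j. cis (p j)) [0..<l] ! ((j + 1) mod l) = cis (p (Suc j))"
proof (cases "Suc j = l")
  case True
  then show ?thesis
    using assms by (simp flip: cis_mult)
next
  case False
  then show ?thesis
    using assms by simp
qed

text \<open>The branch in \<open>circle_arc\<close> may differ from \<open>p\<close> by full turns.
  Since \<open>b - a < 2 * pi\<close>, the right end is not shifted by more turns than the left end;
  as all points lie in one period, the inner point is shifted exactly like the left end. This would
  give \<open>p j < p k < p (Suc j)\<close>, impossible for increasing \<open>p\<close>.\<close>

lemma cyclicly_ordered_cis:
  fixes p :: "nat \<Rightarrow> real"
  assumes inc: "\<And>j. j < l \<Longrightarrow> p j < p (Suc j)" and period: "p l = p 0 + 2 * pi"
  shows "cyclicly_ordered (map (\<lambda>j. cis (p j)) [0..<l])"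
proof -
  have less: "p i < p j" if "i < j" "j \<le> l" for i j
    using increasing_upto[of l p] inc that by blast
  have le: "p i \<le> p j" if "i \<le> j" "j \<le> l" for i j
    using less[of i j] that by (cases "i = j") auto
  have neq: "cis (p i) \<noteq> cis (p j)" if "i < j" "j < l" for i j
    using that less[of i j] less[of j l] le[of 0 i] period by (intro cis_neq) auto
  have "inj_on (\<lambda>j. cis (p j)) {0..<l}"
    by (intro inj_onI) (metis neq atLeastLessThan_iff linorder_neqE_nat)
  moreover have "cis (p k) \<notin> circle_arc (cis (p j)) (cis (p (Suc j)))" if "j < l" "k < l" for j k
  proof
    assume "cis (p k) \<in> circle_arc (cis (p j)) (cis (p (Suc j)))"
    then obtain a t b where *: "cis (p j) = cis a" "cis (p k) = cis t" "cis (p (Suc j)) = cis b"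
      "b - a < 2 * pi" "a < t" "t < b"
      by (auto simp: circle_arc_def)
    obtain i :: int where i: "a = p j + 2 * pi * i"
      using *(1) by (metis cis_eq_iff)
    obtain i' :: int where i': "t = p k + 2 * pi * i'"
      using *(2) by (metis cis_eq_iff)
    obtain i'' :: int where i'': "b = p (Suc j) + 2 * pi * i''"
      using *(3) by (metis cis_eq_iff)
    have bounds: "p 0 \<le> p j" "p 0 \<le> p k" "p k < p 0 + 2 * pi" "p (Suc j) \<le> p 0 + 2 * pi"
      "p j < p (Suc j)"
      using le[of 0 j] le[of 0 k] less[of k l] le[of "Suc j" l] inc that period by auto
    have "2 * pi * of_int (i'' - i) < 2 * pi * 1"
      using *(4) i i'' bounds by (simp add: algebra_simps)
    then have "i'' \<le> i" by simp
    then have "2 * pi * of_int i'' \<le> 2 * pi * of_int i" by simp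
    then have k: "p j < p k + 2 * pi * of_int (i' - i)" "p k + 2 * pi * of_int (i' - i) < p (Suc j)"
      using *(5,6) unfolding i i' i'' of_int_diff right_diff_distrib by linarith+
    then have "2 * pi * (- 1) < 2 * pi * of_int (i' - i)" "2 * pi * of_int (i' - i) < 2 * pi * 1"
      using bounds by linarith+
    moreover have "0 < 2 * pi" by simp
    ultimately have "- 1 < real_of_int (i' - i)" "real_of_int (i' - i) < 1"
      by (simp_all only: mult_less_cancel_left_pos)
    then have "i' = i" by linarith
    with k have "p j < p k" "p k < p (Suc j)" by auto
    then have "\<not> k \<le> j" "\<not> Suc j \<le> k"
      using le[of k j] le[of "Suc j" k] that by auto
    then show False by simp
  qed
  ultimately show ?thesis
    unfolding cyclicly_ordered_def using cis_next_index[OF period]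
    by (auto simp: distinct_map)
qed

text \<open>Interlacing on the circle is read off from an alternating chain
  \<open>p 0 < q 0 < p 1 < ... < q (l - 1) < p l\<close> that spans exactly one turn.\<close>

lemma strictly_interlace_cis:
  fixes p q :: "nat \<Rightarrow> real"
  assumes "l \<ge> 1"
    and pq: "\<And>j. j < l \<Longrightarrow> p j < q j" and qp: "\<And>j. j < l \<Longrightarrow> q j < p (Suc j)"
    and period: "p l = p 0 + 2 * pi"
  shows "strictly_interlace ((\<lambda>j. cis (p j)) ` {..<l}) ((\<lambda>j. cis (q j)) ` {..<l})"
proof -
  let ?zs = "map (\<lambda>j. cis (p j)) [0..<l]" and ?ws = "map (\<lambda>j. cis (q j)) [0..<l]"
  have inc: "p j < p (Suc j)" if "j < l" for j
    using pq qp that by (meson order.strict_trans)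
  have less: "p i < p j" if "i < j" "j \<le> l" for i j
    using increasing_upto[of l p] inc that by blast
  \<comment> \<open>The value of \<open>q\<close> at \<open>l\<close> is unconstrained; resetting it
    closes the period, as \<open>cyclicly_ordered_cis\<close> requires.\<close>
  define q' where "q' = q(l := q 0 + 2 * pi)"
  have "q' j < q' (Suc j)" if "j < l" for j
  proof (cases "Suc j = l")
    case True
    then show ?thesis
      using that qp[of j] pq[of 0] period by (auto simp: q'_def)
  next
    case False
    then show ?thesis
      using that qp[of j] pq[of "Suc j"] by (auto simp: q'_def)
  qed
  moreover have "q' l = q' 0 + 2 * pi"
    using \<open>l \<ge> 1\<close> by (auto simp: q'_def)
  ultimately have "cyclicly_ordered (map (\<lambda>j. cis (q' j)) [0..<l])"
    by (rule cyclicly_ordered_cis)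
  moreover have "map (\<lambda>j. cis (q' j)) [0..<l] = ?ws"
    by (simp add: q'_def)
  ultimately have ws: "cyclicly_ordered ?ws" by simp
  have "strictly_interlace_list ?zs ?ws"
  \<comment> \<open>For one point the gap from \<open>p 0\<close> to \<open>p 1\<close> is a full
    turn and \<open>circle_arc\<close> is empty, so the separate clause of the definition applies.
    For more points every gap is shorter than a turn.\<close>
  proof (cases "l = 1")
    case True
    then show ?thesis
      using pq[of 0] qp[of 0] period cis_neq[of "p 0" "q 0"]
      by (auto simp: strictly_interlace_list_def)
  next
    case False
    have "cis (q j) \<in> circle_arc (cis (p j)) (cis (p (Suc j)))" if "j < l" for j
    proof -
      have "p (Suc j) - p j < 2 * pi"
        using False that less[of 0 j] less[of "Suc j" l] period \<open>l \<ge> 1\<close>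
        by (cases "j = 0"; cases "Suc j = l") auto
      then show ?thesis
        unfolding circle_arc_def mem_Collect_eq using inc[OF that] pq[OF that] qp[OF that]
        by (intro exI[of _ "p j"] exI[of _ "q j"] exI[of _ "p (Suc j)"]) simp
    qed
    then have "\<forall>j<l. rotate 0 ?ws ! j \<in> circle_arc (?zs ! j) (?zs ! ((j + 1) mod l))"
      using cis_next_index[OF period] by simp
    then have "\<exists>m. \<forall>j<l. rotate m ?ws ! j \<in> circle_arc (?zs ! j) (?zs ! ((j + 1) mod l))"
      by (rule exI)
    then show ?thesis
      unfolding strictly_interlace_list_def length_map length_upt diff_zero
      using False by (simp only: if_False simp_thms)
  qed
  moreover have "cyclicly_ordered ?zs"
    using inc period by (rule cyclicly_ordered_cis)
  moreover have "set ?zs = (\<lambda>j. cis (p j)) ` {..<l}" "set ?ws = (\<lambda>j. cis (q j)) ` {..<l}"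
    by (auto simp: atLeast0LessThan)
  ultimately show ?thesis
    unfolding strictly_interlace_def using ws by blast
qed

section \<open>Lifts of coverings of the circle by itself, and their level sets\<close>

definition circle_lift :: "nat \<Rightarrow> (real \<Rightarrow> real) \<Rightarrow> bool" where
  "circle_lift l f \<longleftrightarrow> continuous_on UNIV f \<and> strict_mono f \<and>
     (\<forall>t. f (t + 2 * pi) = f t + 2 * pi * l)"

text \<open>For a circle lift of degree \<open>l\<close>, this is the fibre over 1 of the
  \<open>l\<close>-fold covering that it lifts.\<close>

definition level_points :: "(real \<Rightarrow> real) \<Rightarrow> complex set" where
  "level_points f = {cis t | t. \<exists>k::int. f t = 2 * pi * k}"

lemma circle_lift_shift:
  assumes "\<And>t. f (t + 2 * pi) = f t + c"
  shows "f (t + 2 * pi * of_int k) = f t + c * of_int k"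
proof (induction k arbitrary: t rule: int_induct[of _ 0])
  case (step1 i)
  then show ?case
    using assms[of "t + 2 * pi * i"] by (simp add: algebra_simps)
next
  case (step2 i)
  then show ?case
    using assms[of "t + 2 * pi * (i - 1)"] by (simp add: algebra_simps)
qed simp

lemma circle_lift_add_int:
  "circle_lift l f \<Longrightarrow> f (t + 2 * pi * of_int k) = f t + 2 * pi * l * of_int k"
  by (rule circle_lift_shift) (simp add: circle_lift_def)

lemma circle_lift_surj:
  assumes "circle_lift l f" "l \<ge> 1"
  shows "surj f"
proof -
  have "\<exists>t. f t = y" for y
  proof -
    \<comment> \<open>Since \<open>2 * pi * l\<close> is at least 1, \<open>k\<close> periods in
      either direction carry the value from \<open>f 0\<close> to or past \<open>y\<close>; the
      intermediate value theorem does the rest.\<close>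
    define k where "k = \<lceil>\<bar>y - f 0\<bar>\<rceil>"
    have k: "\<bar>y - f 0\<bar> \<le> of_int k" "0 \<le> real_of_int k"
      unfolding k_def by linarith+
    have "1 * of_int k \<le> 2 * pi * l * real_of_int k"
    proof (rule mult_right_mono)
      have "1 * 1 \<le> (2 * pi) * real l"
        using \<open>l \<ge> 1\<close> pi_gt3 by (intro mult_mono) auto
      then show "1 \<le> 2 * pi * real l" by simp
    qed (use k in auto)
    then have "f (2 * pi * of_int (- k)) \<le> y" "y \<le> f (2 * pi * of_int k)"
      using circle_lift_add_int[OF assms(1), of 0 k] circle_lift_add_int[OF assms(1), of 0 "- k"] k
      by (auto simp: abs_le_iff)
    moreover have "continuous_on S f" for S
      using assms(1) continuous_on_subset unfolding circle_lift_def by blast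
    moreover have "2 * pi * of_int (- k) \<le> 2 * pi * real_of_int k"
      using k by simp
    ultimately show ?thesis
      using IVT'[of f] by blast
  qed
  then show ?thesis by (metis surjI)
qed

lemma circle_lift_lessD: "circle_lift l f \<Longrightarrow> f s < f t \<Longrightarrow> s < t"
  by (simp add: circle_lift_def strict_mono_less)

lemma circle_lift_compose:
  assumes "circle_lift 1 f" "circle_lift l g"
  shows "circle_lift l (\<lambda>t. f (g t))"
proof -
  have "continuous_on UNIV (\<lambda>t. f (g t))"
    using assms continuous_on_compose2[of UNIV f UNIV g] by (auto simp: circle_lift_def)
  moreover have "f (x + 2 * pi * real l) = f x + 2 * pi * real l" for x
    using circle_lift_add_int[OF assms(1), of x "int l"] by simp
  ultimately show ?thesis
    using assms by (simp add: circle_lift_def strict_mono_def)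
qed

lemma circle_lift_add_id:
  "circle_lift l f \<Longrightarrow> circle_lift (Suc l) (\<lambda>t. t + f t)"
  unfolding circle_lift_def strict_mono_def
  by (auto intro!: continuous_intros add_strict_mono simp: distrib_left)

lemma circle_lift_diff_const:
  "circle_lift l f \<Longrightarrow> circle_lift l (\<lambda>t. f t - c)"
  by (auto simp: circle_lift_def strict_mono_def intro!: continuous_intros)

text \<open>Another argument of the same point changes \<open>f t\<close> only by a multiple of
  \<open>2 * pi\<close>, so any argument may be tested.\<close>

lemma cis_mem_level_points:
  assumes "circle_lift l f"
  shows "cis t \<in> level_points f \<longleftrightarrow> (\<exists>k::int. f t = 2 * pi * k)"
proof
  assume "cis t \<in> level_points f"
  then obtain s and k :: int where "cis t = cis s" "f s = 2 * pi * k"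
    by (auto simp: level_points_def)
  moreover from this obtain i :: int where "t = s + 2 * pi * i"
    by (auto simp: cis_eq_iff)
  ultimately have "f t = 2 * pi * of_int (k + int l * i)"
    using circle_lift_add_int[OF assms] by (simp add: algebra_simps)
  then show "\<exists>k::int. f t = 2 * pi * k" by blast
qed (auto simp: level_points_def)

text \<open>The solutions of \<open>f t = 2 * pi * k\<close> for \<open>l\<close> consecutive values of \<open>k\<close> fill one period.\<close>

lemma level_points_enumerate:
  fixes m :: int
  assumes f: "circle_lift l f" and "l \<ge> 1"
  defines "x \<equiv> \<lambda>j::nat. cis (inv f (2 * pi * (m + j)))"
  shows "level_points f = x ` {..<l}" and "inj_on x {..<l}"
proof -
  have f_inv: "f (inv f y) = y" for y
    using circle_lift_surj[OF f \<open>l \<ge> 1\<close>] by (rule surj_f_inv_f)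
  have inv_f: "inv f (f t) = t" for t
    using f by (simp add: circle_lift_def strict_mono_imp_inj_on)
  show "level_points f = x ` {..<l}"
  proof (intro equalityI subsetI)
    fix z
    assume "z \<in> level_points f"
    then obtain t and k :: int where t: "z = cis t" "f t = 2 * pi * k"
      by (auto simp: level_points_def)
    \<comment> \<open>Division with remainder by \<open>l\<close>: moving \<open>t\<close> back by
      \<open>d\<close> periods brings its level to \<open>m + r\<close> with
      \<open>r < l\<close>.\<close>
    define d r where "d = (k - m) div int l" and "r = nat ((k - m) mod int l)"
    have "r < l" and "int r = (k - m) mod int l"
      using \<open>l \<ge> 1\<close> by (simp_all add: r_def nat_less_iff)
    then have "k = int l * d + int r + m"
      using mult_div_mod_eq[of "int l" "k - m"] unfolding d_def by linarith
    then have k: "real_of_int k = real l * d + real r + m"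
      by simp
    have "f (t + 2 * pi * of_int (- d)) = 2 * pi * (m + r)"
      unfolding circle_lift_add_int[OF f] t(2) k by (simp add: algebra_simps)
    then have "inv f (2 * pi * (m + r)) = t + 2 * pi * of_int (- d)"
      by (metis inv_f)
    then have "x r = z"
      unfolding x_def t(1) by (simp only: cis_add_2pi_int)
    with \<open>r < l\<close> show "z \<in> x ` {..<l}" by blast
  next
    fix z
    assume "z \<in> x ` {..<l}"
    then obtain j :: nat where "z = cis (inv f (2 * pi * (m + j)))"
      by (auto simp: x_def)
    moreover have "f (inv f (2 * pi * (m + j))) = 2 * pi * of_int (m + int j)"
      by (simp add: f_inv)
    ultimately show "z \<in> level_points f"
      unfolding level_points_def by blast
  qed
  have "x i \<noteq> x j" if "i < j" "j < l" for i j
    unfolding x_def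
  proof (rule cis_neq)
    show "inv f (2 * pi * (m + i)) < inv f (2 * pi * (m + j))"
      using that by - (rule circle_lift_lessD[OF f], simp add: f_inv)
    have "2 * pi * real j < 2 * pi * (real i + real l)"
      using that by simp
    moreover have period: "f (t + 2 * pi) = f t + 2 * pi * l" for t
      using f by (simp add: circle_lift_def)
    ultimately have "f (inv f (2 * pi * (m + j))) < f (inv f (2 * pi * (m + i)) + 2 * pi)"
      unfolding period f_inv by (simp add: distrib_left)
    then show "inv f (2 * pi * (m + j)) < inv f (2 * pi * (m + i)) + 2 * pi"
      by (rule circle_lift_lessD[OF f])
  qed
  then show "inj_on x {..<l}"
    by (intro inj_onI) (metis lessThan_iff linorder_neqE_nat)
qed

lemma card_level_points:
  assumes "circle_lift l f" "l \<ge> 1"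
  shows "card (level_points f) = l"
  using level_points_enumerate[OF assms, of 0] by (simp add: card_image)

text \<open>Normalizing \<open>f s\<close> to one turn fixes which levels occur between
  \<open>s\<close> and \<open>s + 2 * pi\<close>. Where \<open>f\<close> takes the value
  \<open>2 * pi * j\<close>, the sum exceeds it by \<open>t - s\<close>, which is strictly between 0
  and \<open>2 * pi\<close> inside this window; this places each level of the sum between
  neighbouring points. The case \<open>f s = 0\<close> is that of a common point.\<close>

lemma level_points_interlace:
  fixes f :: "real \<Rightarrow> real" and s :: real
  assumes f: "circle_lift n f" and n: "n \<ge> 1" and fs: "0 \<le> f s" "f s < 2 * pi"
  defines "Z \<equiv> level_points f" and "Z' \<equiv> level_points (\<lambda>t. f t + (t - s))"
  shows "(Z \<inter> Z' = {} \<and> cis s \<notin> Z \<and> cis s \<notin> Z' \<and> strictly_interlace (Z \<union> {cis s}) Z') \<or>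
     ((\<exists>!z. z \<in> Z \<inter> Z') \<and> cis s \<in> Z \<inter> Z' \<and> strictly_interlace Z (Z' - {cis s}))"
proof -
  define g where "g = (\<lambda>t. f t + (t - s))"
  have g: "circle_lift (Suc n) g"
    using circle_lift_diff_const[OF circle_lift_add_id[OF f], of s]
    by (simp add: g_def algebra_simps)
  have Z': "Z' = level_points g"
    by (simp add: Z'_def g_def)
  have f_inv: "f (inv f y) = y" for y
    using circle_lift_surj[OF f n] by (rule surj_f_inv_f)
  have g_inv: "g (inv g y) = y" for y
    using circle_lift_surj[OF g] by (simp add: surj_f_inv_f)
  have gs: "g s = f s"
    by (simp add: g_def)
  have f_period: "f (s + 2 * pi) = f s + 2 * pi * n" and g_period: "g (s + 2 * pi) = g s + 2 * pi * Suc n"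
    using f g by (simp_all only: circle_lift_def)
  \<comment> \<open>One period is scanned from \<open>s\<close>. The list \<open>q\<close> starts at
    level \<open>2 * pi\<close> because \<open>g s = f s\<close> already lies in the turn from
    0.\<close>
  define p where "p = (\<lambda>j::nat. if j = 0 then s else inv f (2 * pi * j))"
  define q where "q = (\<lambda>j::nat. inv g (2 * pi * (1 + j)))"
  have p_gt: "s < p j" if "1 \<le> j" for j
  proof -
    have "2 * pi * 1 \<le> 2 * pi * real j"
      using that by (intro mult_left_mono) auto
    then show ?thesis
      using that fs by - (rule circle_lift_lessD[OF f], auto simp: p_def f_inv intro: less_le_trans)
  qed
  have gp: "g (p j) = 2 * pi * j + (p j - s)" if "1 \<le> j" for j
    using that by (simp add: g_def p_def f_inv)
  have pq: "p j < q j" if "p j < s + 2 * pi" for j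
  proof (rule circle_lift_lessD[OF g])
    show "g (p j) < g (q j)"
      using that fs gp[of j] by (cases "j = 0") (auto simp: q_def g_inv p_def gs algebra_simps)
  qed
  have qp: "q j < p (Suc j)" for j
  proof (rule circle_lift_lessD[OF g])
    show "g (q j) < g (p (Suc j))"
      using gp[of "Suc j"] p_gt[of "Suc j"] by (auto simp: q_def g_inv algebra_simps)
  qed
  have common: "cis t = cis s" if t: "cis t \<in> Z" "cis t \<in> Z'" for t
  proof -
    obtain k k' :: int where "f t = 2 * pi * k" "g t = 2 * pi * k'"
      using t cis_mem_level_points[OF f] cis_mem_level_points[OF g] by (auto simp: Z_def Z')
    then have "t = s + 2 * pi * of_int (k' - k)"
      by (simp add: g_def algebra_simps)
    then show ?thesis
      by (simp only: cis_add_2pi_int)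
  qed
  have common': "z = cis s" if "z \<in> Z" "z \<in> Z'" for z
    using common that by (auto simp: Z_def level_points_def)
  have mem: "cis s \<in> Z \<longleftrightarrow> f s = 0" "cis s \<in> Z' \<longleftrightarrow> f s = 0"
  proof -
    have "k = 0" if "f s = 2 * pi * k" for k :: int
    proof -
      have "0 \<le> 2 * pi * of_int k" "2 * pi * of_int k < 2 * pi * 1"
        using fs that by auto
      then have "0 \<le> k" "k < 1"
        using pi_gt_zero by (simp_all add: zero_le_mult_iff not_le[symmetric] del: pi_gt_zero)
      then show ?thesis by simp
    qed
    then have "(\<exists>k::int. f s = 2 * pi * k) \<longleftrightarrow> f s = 0"
      by (metis mult_zero_right of_int_0)
    then show "cis s \<in> Z \<longleftrightarrow> f s = 0" "cis s \<in> Z' \<longleftrightarrow> f s = 0"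
      using cis_mem_level_points[OF f] cis_mem_level_points[OF g] by (simp_all add: Z_def Z' gs)
  qed
  show ?thesis
  proof (cases "f s = 0")
    case False
    \<comment> \<open>Here \<open>f s > 0\<close>, so \<open>s\<close> is an extra point: it is
      followed by the levels \<open>2 * pi, ..., 2 * pi * n\<close> of \<open>f\<close>, all reached
      before \<open>s + 2 * pi\<close>. Index \<open>Suc n\<close> is reset to close the
      period.\<close>
    define p' where "p' = p(Suc n := s + 2 * pi)"
    have p_lt: "p j < s + 2 * pi" if "j \<le> n" for j
    proof -
      have "2 * pi * real j \<le> 2 * pi * real n"
        using that by (intro mult_left_mono) auto
      then have "2 * pi * real j < f s + 2 * pi * real n" "f s < f s + 2 * pi * real n"
        using False fs(1) n by (linarith, simp)
      then have "f (p j) < f (s + 2 * pi)"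
        unfolding f_period by (simp add: f_inv p_def)
      then show ?thesis
        by (rule circle_lift_lessD[OF f])
    qed
    have q_lt: "q n < s + 2 * pi"
    proof (rule circle_lift_lessD[OF g])
      have "f s > 0"
        using False fs by simp
      then show "g (q n) < g (s + 2 * pi)"
        unfolding g_period gs q_def g_inv by simp
    qed
    have "strictly_interlace ((\<lambda>j. cis (p' j)) ` {..<Suc n}) ((\<lambda>j. cis (q j)) ` {..<Suc n})"
    proof (rule strictly_interlace_cis)
      show "p' j < q j" "q j < p' (Suc j)" if "j < Suc n" for j
        using that pq[of j] p_lt[of j] qp[of j] q_lt by (auto simp: p'_def)
      show "p' (Suc n) = p' 0 + 2 * pi"
        by (simp add: p'_def p_def)
    qed simp
    moreover have "(\<lambda>j. cis (q j)) ` {..<Suc n} = Z'"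
      unfolding Z' using level_points_enumerate(1)[OF g, of 1] by (simp add: q_def)
    moreover have "(\<lambda>j. cis (p' j)) ` {..<Suc n} = Z \<union> {cis s}"
    proof -
      have "(\<lambda>j. cis (p' j)) ` {..<Suc n} = insert (cis (p' 0)) ((\<lambda>j. cis (p' (Suc j))) ` {..<n})"
        by (simp add: lessThan_Suc_eq_insert_0 image_image)
      also have "(\<lambda>j. cis (p' (Suc j))) ` {..<n} = Z"
        unfolding Z_def level_points_enumerate(1)[OF f n, of 1] by (simp add: p'_def p_def)
      finally show ?thesis
        by (simp add: p'_def p_def)
    qed
    ultimately show ?thesis
      using mem False common' by auto
  next
    case True
    have inv_f: "inv f (f t) = t" "inv g (g t) = t" for t
      using f g by (simp_all add: circle_lift_def strict_mono_imp_inj_on)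
    \<comment> \<open>Now \<open>s\<close> is itself the level-0 point of \<open>f\<close>, and the
      period closes already at index \<open>n\<close>.\<close>
    have p0: "p 0 = inv f (2 * pi * (0 + real 0))"
      using inv_f(1)[of s] True by (simp add: p_def)
    have pn: "p n = s + 2 * pi"
      using inv_f(1)[of "s + 2 * pi"] n True by (simp add: p_def f_period)
    have "strictly_interlace ((\<lambda>j. cis (p j)) ` {..<n}) ((\<lambda>j. cis (q j)) ` {..<n})"
    proof (rule strictly_interlace_cis)
      show "p j < q j" if "j < n" for j
      proof (rule pq)
        show "p j < s + 2 * pi"
          using that True f_period
          by - (rule circle_lift_lessD[OF f], auto simp: f_inv p_def)
      qed
      show "p n = p 0 + 2 * pi"
        using pn by (simp add: p_def)
    qed (use n qp in auto)
    moreover have "(\<lambda>j. cis (p j)) ` {..<n} = Z"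
    proof -
      have "p j = inv f (2 * pi * (real_of_int 0 + real j))" for j
        using p0 by (cases "j = 0") (auto simp: p_def)
      then show ?thesis
        unfolding Z_def level_points_enumerate(1)[OF f n, of 0] by simp
    qed
    moreover have "(\<lambda>j. cis (q j)) ` {..<n} = Z' - {cis s}"
    proof -
      \<comment> \<open>Enumerating from level 0 puts \<open>cis s\<close> at index 0; by
        injectivity, deleting that point deletes only this index and leaves the points of
        \<open>q\<close>.\<close>
      let ?x = "\<lambda>j::nat. cis (inv g (2 * pi * (real_of_int 0 + real j)))"
      have x0: "?x 0 = cis s"
        using inv_f(2)[of s] True gs by simp
      have *: "Z' = ?x ` {..<Suc n}" "inj_on ?x {..<Suc n}"
        unfolding Z' using level_points_enumerate[OF g, of 0] by auto
      have "Z' - {cis s} = ?x ` ({..<Suc n} - {0})"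
        using * x0 by (subst inj_on_image_set_diff[OF *(2)]) auto
      also have "{..<Suc n} - {0} = Suc ` {..<n}"
        by (auto simp: lessThan_Suc_eq_insert_0)
      finally show ?thesis
        by (simp add: image_image q_def)
    qed
    ultimately have "strictly_interlace Z (Z' - {cis s})"
      by (simp only:)
    moreover have "Z \<inter> Z' = {cis s}"
      using mem True common' by blast
    ultimately show ?thesis by simp
  qed
qed

section \<open>Lifts of disc automorphisms\<close>

text \<open>
  With \<open>w = 1 - cnj a * cis t\<close>, the disc automorphism is \<open>cis t * cnj w / w\<close>, and \<open>w\<close> stays in the
  right half-plane, so its principal argument is continuous in \<open>t\<close>.
\<close>

definition moebius_lift :: "complex \<Rightarrow> real \<Rightarrow> real" where
  "moebius_lift a t = t - 2 * Im (Ln (1 - cnj a * cis t))"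

lemma one_minus_cnj_mult_nonzero:
  assumes "norm a < 1" "norm z = 1"
  shows "1 - cnj a * z \<noteq> 0"
proof
  assume "1 - cnj a * z = 0"
  then have "norm (cnj a * z) = 1"
    by (metis eq_iff_diff_eq_0 norm_one)
  with assms show False by (simp add: norm_mult)
qed

lemma cis_moebius_lift:
  assumes "norm a < 1"
  shows "cis (moebius_lift a t) = (cis t - a) / (1 - cnj a * cis t)"
proof -
  define w where "w = 1 - cnj a * cis t"
  have "w \<noteq> 0"
    using assms unfolding w_def by (intro one_minus_cnj_mult_nonzero) auto
  define y where "y = Im (Ln w)"
  have w: "w = norm w * cis y"
    using \<open>w \<noteq> 0\<close> by (metis exp_Ln exp_eq_polar exp_of_real norm_exp_eq_Re y_def)
  have "cis t - a = cis t * cnj w"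
    by (simp add: w_def algebra_simps cis_cnj cis_mult)
  also have "cnj w = w * cis (- 2 * y)"
    by (subst (1 2) w) (simp add: cis_cnj mult.assoc cis_mult)
  also have "cis t * (w * cis (- 2 * y)) = w * cis (moebius_lift a t)"
    by (simp add: moebius_lift_def cis_mult y_def w_def)
  finally show ?thesis
    using \<open>w \<noteq> 0\<close> by (simp add: w_def)
qed

lemma moebius_inj:
  fixes z w :: complex
  assumes "norm a < 1" "norm z = 1" "norm w = 1"
    "(z - a) / (1 - cnj a * z) = (w - a) / (1 - cnj a * w)"
  shows "z = w"
proof -
  have "(z - a) * (1 - cnj a * w) = (w - a) * (1 - cnj a * z)"
    using assms one_minus_cnj_mult_nonzero by (simp add: frac_eq_eq)
  then have "(z - w) * (1 - a * cnj a) = 0"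
    by (simp add: algebra_simps)
  moreover have "(norm a)\<^sup>2 \<noteq> 1"
    using assms(1) abs_square_eq_1[of "norm a"] by auto
  then have "1 - a * cnj a \<noteq> 0"
    by (metis complex_norm_square eq_iff_diff_eq_0 of_real_eq_1_iff)
  ultimately show ?thesis by simp
qed

text \<open>
  Monotonicity is topological: the lift is injective because the automorphism is, and it gains
  \<open>2 * pi\<close> over a period.
\<close>

lemma circle_lift_moebius:
  assumes "norm a < 1"
  shows "circle_lift 1 (moebius_lift a)"
proof -
  have cont: "continuous_on S (moebius_lift a)" for S
  proof -
    have "1 - cnj a * cis t \<notin> \<real>\<^sub>\<le>\<^sub>0" for t
    proof -
      have "Re (cnj a * cis t) \<le> norm (cnj a * cis t)"
        by (rule complex_Re_le_cmod)
      also have "\<dots> < 1"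
        using assms by (simp add: norm_mult)
      finally show ?thesis
        by (simp add: complex_nonpos_Reals_iff)
    qed
    then show ?thesis
      unfolding moebius_lift_def cis_conv_exp by (intro continuous_intros) (auto simp: cis_conv_exp)
  qed
  have period: "moebius_lift a (t + 2 * pi) = moebius_lift a t + 2 * pi" for t
    by (simp add: moebius_lift_def flip: cis_mult)
  have shift: "moebius_lift a (t + 2 * pi * of_int k) = moebius_lift a t + 2 * pi * of_int k" for t k
    using period by (rule circle_lift_shift)
  have inj: "inj (moebius_lift a)"
  proof (rule injI)
    fix s t
    assume eq: "moebius_lift a s = moebius_lift a t"
    then have "cis s = cis t"
      using cis_moebius_lift[OF assms] assms by (metis moebius_inj norm_cis)
    then obtain k :: int where "s = t + 2 * pi * k"
      by (auto simp: cis_eq_iff)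
    with eq shift show "s = t" by simp
  qed
  have "moebius_lift a s < moebius_lift a t" if "s < t" for s t
  proof -
    \<comment> \<open>\<open>k\<close> periods from \<open>s\<close> reach beyond \<open>t\<close>.
      On this interval a continuous injection is monotone, and its end values exclude the decreasing
      case.\<close>
    define k where "k = \<lceil>t - s\<rceil> + 1"
    have k: "t - s < of_int k" "0 \<le> real_of_int k"
      using that unfolding k_def by linarith+
    have "1 * of_int k \<le> 2 * pi * real_of_int k"
      using k pi_gt3 by (intro mult_right_mono) auto
    then have "t < s + 2 * pi * of_int k" "moebius_lift a s \<le> moebius_lift a (s + 2 * pi * of_int k)"
      using k shift by auto
    then show ?thesis
      using continuous_inj_imp_mono[OF that _ cont inj_on_subset[OF inj]] by force
  qed
  then show ?thesis
    using cont period by (auto simp: circle_lift_def strict_mono_def)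
qed

section \<open>Phases of orthogonal polynomials\<close>

text \<open>
  \<open>\<eta>\<close> is a continuous argument of the Blaschke product \<open>z * p / p\<^sup>*\<close>. The factor \<open>z\<close> makes it
  strictly increasing also for constant \<open>p\<close>.
\<close>

definition circle_phase :: "complex poly \<Rightarrow> (real \<Rightarrow> real) \<Rightarrow> bool" where
  "circle_phase p \<eta> \<longleftrightarrow> circle_lift (Suc (degree p)) \<eta> \<and>
     (\<forall>t. poly (rev_star p) (cis t) \<noteq> 0 \<and>
          cis t * poly p (cis t) = cis (\<eta> t) * poly (rev_star p) (cis t))"

text \<open>A lift of degree 1 both preserves and reflects congruence modulo \<open>2 * pi\<close>.
  The zeros belonging to a phase can thus be described after the disc automorphism that produces the
  next phase.\<close>

lemma level_points_moebius:
  assumes a: "norm a < 1"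
  shows "level_points (\<lambda>t. moebius_lift a (f t) - moebius_lift a c) = level_points (\<lambda>t. f t - c)"
proof -
  note L = circle_lift_moebius[OF a]
  have "moebius_lift a (f t) - moebius_lift a c = 2 * pi * k \<longleftrightarrow> f t - c = 2 * pi * k"
    for t and k :: int
  proof -
    have "moebius_lift a (f t) - moebius_lift a c = 2 * pi * k \<longleftrightarrow>
        moebius_lift a (f t) = moebius_lift a (c + 2 * pi * k)"
      using circle_lift_add_int[OF L, of c k] by auto
    also have "\<dots> \<longleftrightarrow> f t = c + 2 * pi * k"
      using L by (auto simp: circle_lift_def strict_mono_eq)
    finally show ?thesis by auto
  qed
  then show ?thesis
    by (simp add: level_points_def)
qed

lemma level_points_diff_2pi_int:
  "level_points (\<lambda>t. f t - 2 * pi * of_int m) = level_points f"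
proof -
  have "(\<exists>k::int. x - 2 * pi * of_int m = 2 * pi * k) \<longleftrightarrow> (\<exists>k::int. x = 2 * pi * k)" for x
  proof (intro iffI; elim exE)
    fix k :: int
    assume "x - 2 * pi * of_int m = 2 * pi * k"
    then have "x = 2 * pi * of_int (k + m)" by (simp add: algebra_simps)
    then show "\<exists>k::int. x = 2 * pi * k" by blast
  next
    fix k :: int
    assume "x = 2 * pi * k"
    then have "x - 2 * pi * of_int m = 2 * pi * of_int (k - m)" by (simp add: algebra_simps)
    then show "\<exists>k::int. x - 2 * pi * of_int m = 2 * pi * k" by blast
  qed
  then show ?thesis by (simp add: level_points_def)
qed

text \<open>With \<open>a = \<alpha> (n - 1)\<close>, the fraction times \<open>\<beta> n\<close> is
  \<open>(1 - a * cis B) / (cis B - cnj a)\<close>, the reciprocal of the disc automorphism with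
  parameter \<open>cnj a\<close> at \<open>cis B\<close>.\<close>

lemma interlacing_point_eq_cis:
  assumes "cnj (\<beta> n) = cis B" "cnj (\<beta> (n + 1)) = cis B'" and a: "norm (\<alpha> (n - 1)) < 1"
  shows "interlacing_point \<alpha> \<beta> n = cis (B' - moebius_lift (cnj (\<alpha> (n - 1))) B)"
proof -
  define a where "a = \<alpha> (n - 1)"
  have b: "\<beta> n = inverse (cis B)"
    using assms(1) by (metis cis_cnj cis_inverse complex_cnj_cnj)
  have ne: "1 - a * cis B \<noteq> 0"
    using a one_minus_cnj_mult_nonzero[of "cnj a" "cis B"] by (simp add: a_def)
  have "norm (cnj a) \<noteq> norm (cis B)"
    using a by (simp add: a_def)
  then have ne': "cis B - cnj a \<noteq> 0"
    by (metis eq_iff_diff_eq_0)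
  have "interlacing_point \<alpha> \<beta> n =
      cis B' * inverse (cis B) * ((cis B * a - 1) / (inverse (cis B) * cnj a - 1))"
    unfolding interlacing_point_def assms(1,2) a_def[symmetric] by (simp only: b)
  also have "\<dots> = cis B' * (inverse (cis B) * ((cis B * a - 1) / (inverse (cis B) * cnj a - 1)))"
    by (simp only: mult.assoc)
  also have "inverse (cis B) * ((cis B * a - 1) / (inverse (cis B) * cnj a - 1)) =
      (1 - a * cis B) / (cis B - cnj a)"
  proof -
    have "inverse (cis B) * cnj a - 1 = - (cis B - cnj a) / cis B"
      by (simp add: field_simps)
    then show ?thesis
      using ne' by (simp add: divide_simps) (simp add: algebra_simps)
  qed
  also have "\<dots> = inverse (cis (moebius_lift (cnj a) B))"
    using a by (simp add: cis_moebius_lift a_def)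
  finally show ?thesis
    by (simp add: a_def cis_mult)
qed

context circle_measure
begin

text \<open>Let \<open>u\<close> be \<open>z\<close> times the polynomial over its reversal. The
  recursion and its reversed form yield \<open>u - cnj a\<close> and \<open>1 - a * u\<close> times
  the old reversal, so the new quotient is a disc automorphism applied to \<open>u\<close>; the
  extra factor \<open>z\<close> adds \<open>t\<close>. The new reversal has no zero on the circle
  since \<open>norm (a * u) < 1\<close>.\<close>

lemma circle_phase_Suc:
  assumes "circle_phase (OPUC M n) \<eta>"
  shows "circle_phase (OPUC M (Suc n)) (\<lambda>t. t + moebius_lift (cnj (verblunsky M n)) (\<eta> t))"
proof -
  define a where "a = verblunsky M n"
  define p where "p = OPUC M n"
  have a: "norm a < 1"
    by (simp add: a_def norm_verblunsky_less_one)
  have lift: "circle_lift (Suc (Suc n)) (\<lambda>t. t + moebius_lift (cnj a) (\<eta> t))"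
  proof (rule circle_lift_add_id, rule circle_lift_compose[where g = \<eta>])
    show "circle_lift 1 (moebius_lift (cnj a))"
      using a by (intro circle_lift_moebius) simp
    show "circle_lift (Suc n) \<eta>"
      using assms by (simp add: circle_phase_def)
  qed
  have "poly (rev_star (OPUC M (Suc n))) (cis t) \<noteq> 0 \<and>
      cis t * poly (OPUC M (Suc n)) (cis t) =
      cis (t + moebius_lift (cnj a) (\<eta> t)) * poly (rev_star (OPUC M (Suc n))) (cis t)" for t
  proof -
    define z where "z = cis t"
    define u where "u = cis (\<eta> t)"
    have p: "poly (rev_star p) z \<noteq> 0" "z * poly p z = u * poly (rev_star p) z"
      using assms by (simp_all add: circle_phase_def p_def z_def u_def)
    have z: "z * cnj z = 1" "norm z = 1"
      by (simp_all add: z_def cis_cnj cis_mult)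
    have ne: "1 - a * u \<noteq> 0"
      using a one_minus_cnj_mult_nonzero[of "cnj a" u] by (simp add: u_def)
    have q: "poly (OPUC M (Suc n)) z = z * poly p z - cnj a * poly (rev_star p) z"
      by (simp add: szego_recursion p_def a_def)
    have "poly (rev_star (OPUC M (Suc n))) z = z ^ Suc n * cnj (poly (OPUC M (Suc n)) z)"
      using z by (simp add: poly_rev_star_circle)
    also have "\<dots> = (z * cnj z) * (z ^ n * cnj (poly p z))
        - a * (z * ((z * cnj z) ^ n * poly p z))"
      using z(2) by (simp add: q poly_rev_star_circle p_def algebra_simps)
    also have "\<dots> = poly (rev_star p) z - a * (z * poly p z)"
      using z by (simp add: poly_rev_star_circle p_def)
    finally have r: "poly (rev_star (OPUC M (Suc n))) z = (1 - a * u) * poly (rev_star p) z"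
      by (simp add: p algebra_simps)
    have "poly (OPUC M (Suc n)) z = (u - cnj a) * poly (rev_star p) z"
      by (simp add: q p algebra_simps)
    moreover have "cis (moebius_lift (cnj a) (\<eta> t)) = (u - cnj a) / (1 - a * u)"
      using a by (simp add: cis_moebius_lift u_def)
    ultimately show ?thesis
      using ne p(1) r by (simp add: z_def[symmetric] flip: cis_mult)
  qed
  with lift show ?thesis
    by (simp add: circle_phase_def a_def)
qed

lemma circle_phase_exists: "\<exists>\<eta>. circle_phase (OPUC M n) \<eta>"
proof (induction n)
  case 0
  have "OPUC M 0 = 1"
    by (rule OPUC_eqI) (simp add: is_monic_OP_def)
  then have "circle_phase (OPUC M 0) (\<lambda>t. t)"
    by (simp add: circle_phase_def circle_lift_def strict_mono_def rev_star_def)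
  then show ?case by blast
qed (use circle_phase_Suc in blast)

text \<open>By counting: the level points are \<open>Suc n\<close> distinct roots of a nonzero
  polynomial of degree at most \<open>Suc n\<close>, so there are no others, on or off the
  circle.\<close>

lemma zeros_POPUC:
  assumes \<eta>: "circle_phase (OPUC M n) \<eta>" and b: "cnj b = cis B"
  shows "zeros (POPUC M (Suc n) b) = level_points (\<lambda>t. \<eta> t - B)"
proof -
  define q where "q = POPUC M (Suc n) b"
  have q: "q = [:0, 1:] * OPUC M n - smult (cnj b) (rev_star (OPUC M n))"
    by (simp add: q_def POPUC_def)
  have lift: "circle_lift (Suc n) (\<lambda>t. \<eta> t - B)"
    using \<eta> by (intro circle_lift_diff_const) (simp add: circle_phase_def)
  have deg_rev: "coeff (rev_star (OPUC M n)) i = 0" if "i > n" for i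
    using degree_rev_star_le[of "OPUC M n"] that by (simp add: coeff_eq_0)
  have "q \<noteq> 0"
  proof
    assume "q = 0"
    moreover have "coeff q (Suc n) = 1"
      by (simp add: q deg_rev)
    ultimately show False by simp
  qed
  have "degree q \<le> Suc n"
    by (rule degree_le) (auto simp: q deg_rev coeff_pCons coeff_eq_0 split: nat.split)
  moreover have "card (zeros q) \<le> degree q"
    unfolding zeros_def using \<open>q \<noteq> 0\<close> by (rule card_poly_roots_bound)
  ultimately have "card (zeros q) \<le> card (level_points (\<lambda>t. \<eta> t - B))"
    using card_level_points[OF lift] by simp
  moreover have "finite (zeros q)"
    unfolding zeros_def using \<open>q \<noteq> 0\<close> by (rule poly_roots_finite)
  moreover have "level_points (\<lambda>t. \<eta> t - B) \<subseteq> zeros q"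
  proof
    fix z
    assume "z \<in> level_points (\<lambda>t. \<eta> t - B)"
    then obtain t and k :: int where t: "z = cis t" "\<eta> t = B + 2 * pi * k"
      by (auto simp: level_points_def algebra_simps)
    then have "cis t * poly (OPUC M n) (cis t) = cis B * poly (rev_star (OPUC M n)) (cis t)"
      using \<eta> unfolding circle_phase_def by (metis cis_add_2pi_int)
    then show "z \<in> zeros q"
      by (simp add: zeros_def q b t)
  qed
  ultimately have "level_points (\<lambda>t. \<eta> t - B) = zeros q"
    by (intro card_seteq)
  then show ?thesis
    by (simp add: q_def)
qed

end

theorem theorem1p4:
  fixes M :: "complex measure" and \<beta> :: "nat \<Rightarrow> complex" and n :: nat
  assumes "nontrivial_circle_measure M"
    and "\<And>k. k \<ge> 1 \<Longrightarrow> \<beta> k \<in> sphere 0 1"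
    and "n \<ge> 1"
  defines "Z \<equiv> zeros (POPUC M n (\<beta> n))"
    and "Z' \<equiv> zeros (POPUC M (n + 1) (\<beta> (n + 1)))"
    and "lam \<equiv> interlacing_point (verblunsky M) \<beta> n"
  shows "lam \<in> sphere 0 1 \<and>
    ((Z \<inter> Z' = {} \<and>
        lam \<notin> Z \<and> lam \<notin> Z' \<and> strictly_interlace (Z \<union> {lam}) Z') \<or>
     ((\<exists>!z. z \<in> Z \<inter> Z') \<and>
        lam \<in> Z \<inter> Z' \<and> strictly_interlace Z (Z' - {lam})))"
proof -
  interpret circle_measure M
    by unfold_locales fact
  have cis: "\<exists>B. cnj (\<beta> k) = cis B" if "k \<ge> 1" for k
    using assms(2)[OF that] cis_Arg[of "cnj (\<beta> k)"]
    by (metis complex_mod_cnj dist_0_norm mem_sphere norm_zero sgn_eq div_by_1 of_real_1 zero_neq_one)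
  obtain B where B: "cnj (\<beta> n) = cis B"
    using cis \<open>n \<ge> 1\<close> by blast
  obtain B' where B': "cnj (\<beta> (n + 1)) = cis B'"
    using cis[of "n + 1"] by auto
  obtain \<eta> where \<eta>: "circle_phase (OPUC M (n - 1)) \<eta>"
    using circle_phase_exists by blast
  define L where "L = moebius_lift (cnj (verblunsky M (n - 1)))"
  \<comment> \<open>With this \<open>s\<close>, \<open>f t + (t - s)\<close> is
    \<open>t + L (\<eta> t) - B'\<close> up to full turns.\<close>
  define s where "s = B' - L B"
  \<comment> \<open>Subtracting this number of turns brings \<open>f s\<close> between 0 and
    \<open>2 * pi\<close> and leaves the level points unchanged.\<close>
  define m where "m = \<lfloor>(L (\<eta> s) - L B) / (2 * pi)\<rfloor>"
  define f where "f = (\<lambda>t. L (\<eta> t) - L B - 2 * pi * m)"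
  have norm: "norm (cnj (verblunsky M (n - 1))) < 1"
    by (simp add: norm_verblunsky_less_one)
  have lam: "lam = cis s"
    unfolding lam_def s_def L_def
    using interlacing_point_eq_cis[of \<beta> n B B' "verblunsky M"] B B' norm_verblunsky_less_one by blast
  have lift: "circle_lift n f"
    unfolding f_def
  proof (intro circle_lift_diff_const, rule circle_lift_compose[where g = \<eta>])
    show "circle_lift 1 L"
      using circle_lift_moebius[OF norm] by (simp add: L_def)
    show "circle_lift n \<eta>"
      using \<eta> \<open>n \<ge> 1\<close> by (simp add: circle_phase_def)
  qed
  have Z: "Z = level_points f"
    unfolding f_def level_points_diff_2pi_int L_def level_points_moebius[OF norm] Z_def
    using zeros_POPUC[OF \<eta> B] \<open>n \<ge> 1\<close> by simp
  \<comment> \<open>The next paraorthogonal polynomial is built from \<open>OPUC M n\<close>, one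
    recursion step beyond the phase \<open>\<eta>\<close>; the coefficient of that step has index
    \<open>n - 1\<close>.\<close>
  have "circle_phase (OPUC M n) (\<lambda>t. t + L (\<eta> t))"
    using circle_phase_Suc[OF \<eta>] \<open>n \<ge> 1\<close> by (simp add: L_def)
  then have "Z' = level_points (\<lambda>t. t + L (\<eta> t) - B')"
    unfolding Z'_def Suc_eq_plus1[symmetric] using zeros_POPUC B' by simp
  also have "\<dots> = level_points (\<lambda>t. t + L (\<eta> t) - B' - 2 * pi * m)"
    by (rule level_points_diff_2pi_int[symmetric])
  also have "\<dots> = level_points (\<lambda>t. f t + (t - s))"
    by (rule arg_cong[of _ _ level_points]) (auto simp: f_def s_def)
  finally have Z': "Z' = level_points (\<lambda>t. f t + (t - s))" .
  have "of_int m \<le> (L (\<eta> s) - L B) / (2 * pi)" "(L (\<eta> s) - L B) / (2 * pi) < of_int m + 1"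
    unfolding m_def by linarith+
  then have "0 \<le> f s" "f s < 2 * pi"
    by (simp_all add: f_def field_simps)
  then show ?thesis
    using level_points_interlace[OF lift \<open>n \<ge> 1\<close>] unfolding Z Z' lam by simp
qed

end
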